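(* Let $\mathsf{A}_r^{(n)}\in\mathbb{R}^{J_n\times J_n}$ for $r=1,\dots,R_1$ and $n=1,\dots,N$, and let $\alpha_r^{(n)}$ denote the largest singular value of $\mathsf{A}_r^{(n)}$. For the unforced multilinear time-invariant system $$\mathsf{X}_{t+1}=\sum_{r=1}^{R_1}\mathsf{X}_t\times\{\mathsf{A}_r^{(1)},\dots,\mathsf{A}_r^{(N)}\},\qquad\mathsf{X}_t\in\mathbb{R}^{J_1\times\cdots\times J_N},$$ the equilibrium point $\mathsf{X}=\mathsf{O}$ is 1. stable (in the sense of Lyapunov) if $\sum_{r=1}^{R_1}\prod_{n=1}^N\alpha_r^{(n)}=1$; 2. asymptotically stable (in the sense of Lyapunov) if $\sum_{r=1}^{R_1}\prod_{n=1}^N\alpha_r^{(n)}<1$.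
   Context: The Tucker product of $\mathsf{X}\in\mathbb{R}^{J_1\times\cdots\times J_N}$ with matrices $\mathbf{M}_n\in\mathbb{R}^{J_n\times J_n}$ is $(\mathsf{X}\times\{\mathbf{M}_1,\dots,\mathbf{M}_N\})_{i_1\cdots i_N}=\sum_{j_1,\dots,j_N}\mathsf{X}_{j_1\cdots j_N}(\mathbf{M}_1)_{i_1j_1}\cdots(\mathbf{M}_N)_{i_Nj_N}$. $\|\cdot\|$ is the Frobenius norm and $\mathsf{O}$ the zero tensor. The equilibrium $\mathsf{X}=\mathsf{O}$ is stable if there is $\gamma>0$ with $\|\mathsf{X}_t\|\le\gamma\|\mathsf{X}_0\|$ for all $t\ge 0$ and all initial conditions $\mathsf{X}_0$, and asymptotically stable if $\|\mathsf{X}_t\|\to0$ as $t\to\infty$ for every $\mathsf{X}_0$. In the paper $R_1$ is the Kronecker rank of the even-order tensor $\mathsf{A}=\sum_{r=1}^{R_1}\mathsf{A}_r^{(1)}\circ\cdots\circ\mathsf{A}_r^{(N)}$ ($\circ$ the outer product), i.e. the smallest number of terms in such an expression of $\mathsf{A}$. *)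

theory Defs
  imports Complex_Main "HOL-Library.FuncSet" "Jordan_Normal_Form.Char_Poly"
begin

text \<open>
  A tensor of size \<open>J 1 \<times> \<dots> \<times> J N\<close> is an extensional function on multi-indices. The modes are
  numbered from 1 to \<open>N\<close>; within each mode the indices start at 0, to agree with matrix entries.
\<close>

definition multi_index :: "nat \<Rightarrow> (nat \<Rightarrow> nat) \<Rightarrow> (nat \<Rightarrow> nat) set" where
  "multi_index N J = (\<Pi>\<^sub>E n\<in>{1..N}. {..<J n})"

type_synonym tensor = "(nat \<Rightarrow> nat) \<Rightarrow> real"

definition tensors :: "nat \<Rightarrow> (nat \<Rightarrow> nat) \<Rightarrow> tensor set" where
  "tensors N J = extensional (multi_index N J)"

definition frobenius_norm :: "nat \<Rightarrow> (nat \<Rightarrow> nat) \<Rightarrow> tensor \<Rightarrow> real" where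
  "frobenius_norm N J X = sqrt (\<Sum>i\<in>multi_index N J. (X i)\<^sup>2)"

definition tucker_product ::
  "nat \<Rightarrow> (nat \<Rightarrow> nat) \<Rightarrow> tensor \<Rightarrow> (nat \<Rightarrow> real mat) \<Rightarrow> tensor" where
  "tucker_product N J X M =
     (\<lambda>i\<in>multi_index N J. \<Sum>j\<in>multi_index N J. X j * (\<Prod>n=1..N. M n $$ (i n, j n)))"

definition singular_values :: "real mat \<Rightarrow> real set" where
  "singular_values A = sqrt ` {k. eigenvalue (transpose_mat A * A) k}"

definition largest_singular_value :: "real mat \<Rightarrow> real" where
  "largest_singular_value A = Max (singular_values A)"

text \<open>
  The outer product of \<open>N\<close> matrices is a tensor of order \<open>2 * N\<close> and size
  \<open>J 1 \<times> J 1 \<times> \<dots> \<times> J N \<times> J N\<close>: modes \<open>2 * n - 1\<close> and \<open>2 * n\<close> carry the row and the column index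
  of the \<open>n\<close>-th factor.
\<close>

definition paired_dims :: "(nat \<Rightarrow> nat) \<Rightarrow> nat \<Rightarrow> nat" where
  "paired_dims J m = J ((m + 1) div 2)"

definition outer_product :: "nat \<Rightarrow> (nat \<Rightarrow> nat) \<Rightarrow> (nat \<Rightarrow> real mat) \<Rightarrow> tensor" where
  "outer_product N J M =
     (\<lambda>k\<in>multi_index (2 * N) (paired_dims J). \<Prod>n=1..N. M n $$ (k (2 * n - 1), k (2 * n)))"

definition outer_product_sum ::
  "nat \<Rightarrow> (nat \<Rightarrow> nat) \<Rightarrow> nat \<Rightarrow> (nat \<Rightarrow> nat \<Rightarrow> real mat) \<Rightarrow> tensor" where
  "outer_product_sum N J R M =
     (\<lambda>k\<in>multi_index (2 * N) (paired_dims J). \<Sum>r=1..R. outer_product N J (M r) k)"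

definition kronecker_rank :: "nat \<Rightarrow> (nat \<Rightarrow> nat) \<Rightarrow> tensor \<Rightarrow> nat" where
  "kronecker_rank N J T =
     (LEAST R. \<exists>M. (\<forall>r\<in>{1..R}. \<forall>n\<in>{1..N}. M r n \<in> carrier_mat (J n) (J n)) \<and>
                   T = outer_product_sum N J R M)"

definition mlti_step ::
  "nat \<Rightarrow> (nat \<Rightarrow> nat) \<Rightarrow> nat \<Rightarrow> (nat \<Rightarrow> nat \<Rightarrow> real mat) \<Rightarrow> tensor \<Rightarrow> tensor" where
  "mlti_step N J R A X = (\<lambda>i\<in>multi_index N J. \<Sum>r=1..R. tucker_product N J X (A r) i)"

definition trajectory ::
  "nat \<Rightarrow> (nat \<Rightarrow> nat) \<Rightarrow> (tensor \<Rightarrow> tensor) \<Rightarrow> (nat \<Rightarrow> tensor) \<Rightarrow> bool" where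
  "trajectory N J F X \<longleftrightarrow> X 0 \<in> tensors N J \<and> (\<forall>t. X (Suc t) = F (X t))"

text \<open>
  Both notions concern the zero tensor as the equilibrium. They are the global ones used for linear
  systems, and asymptotic stability is global attractivity alone, not combined with stability.
\<close>

definition zero_stable :: "nat \<Rightarrow> (nat \<Rightarrow> nat) \<Rightarrow> (tensor \<Rightarrow> tensor) \<Rightarrow> bool" where
  "zero_stable N J F \<longleftrightarrow>
     (\<exists>\<gamma>>0. \<forall>X. trajectory N J F X \<longrightarrow>
        (\<forall>t. frobenius_norm N J (X t) \<le> \<gamma> * frobenius_norm N J (X 0)))"

definition zero_asymptotically_stable ::
  "nat \<Rightarrow> (nat \<Rightarrow> nat) \<Rightarrow> (tensor \<Rightarrow> tensor) \<Rightarrow> bool" where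
  "zero_asymptotically_stable N J F \<longleftrightarrow>
     (\<forall>X. trajectory N J F X \<longrightarrow> (\<lambda>t. frobenius_norm N J (X t)) \<longlonglongrightarrow> 0)"

end

(* The Tucker product with M_1, ..., M_N applies the matrices one mode at a time, so its operator
   norm with respect to the Frobenius norm is at most the product of the largest singular values.
   By the triangle inequality one step of the system multiplies the norm by at most
   c = sum_r prod_n alpha_r^(n), hence |X_t| <= c^t |X_0|. *)

theory Submission
  imports Defs "HOL-Analysis.Function_Topology" "HOL-Analysis.L2_Norm"
begin

section \<open>The largest singular value as an operator norm\<close>

lemma scalar_prod_mult_mat_vec:
  fixes A :: "real mat"
  assumes "A \<in> carrier_mat m n"
  shows "(A *\<^sub>v vec n f) \<bullet> (A *\<^sub>v vec n f) = (\<Sum>i<m. (\<Sum>j<n. A $$ (i, j) * f j)\<^sup>2)"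
  using assms by (auto simp: scalar_prod_def power2_eq_square lessThan_atLeast0 intro!: sum.cong)

text \<open>The unit sphere of R^n, modelled by functions on \<open>nat\<close> that vanish from
  \<open>n\<close> on, is a closed subset of a box that is compact by Tychonoff's theorem.\<close>

lemma compact_sphere_fun:
  fixes n :: nat
  shows "compact {f. (\<forall>i\<ge>n. f i = 0) \<and> (\<Sum>i<n. (f i)\<^sup>2) = (1::real)}"
proof -
  let ?S = "\<lambda>i. if i < n then {-1..1} else {0::real}"
  have "compactin (product_topology (\<lambda>i::nat. euclidean) UNIV) (PiE UNIV ?S)"
    unfolding compactin_PiE by auto
  hence box: "compact (PiE UNIV ?S)"
    by (simp add: euclidean_product_topology)
  have "closed {f. (\<Sum>i<n. (f i)\<^sup>2) = (1::real)}"
    by (intro closed_Collect_eq continuous_intros continuous_on_product_coordinates)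
  with box have "compact (PiE UNIV ?S \<inter> {f. (\<Sum>i<n. (f i)\<^sup>2) = 1})"
    by (rule compact_Int_closed)
  \<comment> \<open>On the sphere every square is at most 1, so the box only imposes the zeros from
    \<open>n\<close> on.\<close>
  moreover have "f i \<in> {-1..1}" if "(\<Sum>i<n. (f i)\<^sup>2) = (1::real)" "i < n" for f i
    using member_le_sum[of i "{..<n}" "\<lambda>i. (f i)\<^sup>2"] that
    by (simp add: abs_square_le_1 abs_le_iff)
  hence "f \<in> PiE UNIV ?S \<longleftrightarrow> (\<forall>i\<ge>n. f i = 0)" if "(\<Sum>i<n. (f i)\<^sup>2) = (1::real)" for f
    using that by (simp add: PiE_UNIV_domain Pi_iff) (metis linorder_not_le)
  hence "PiE UNIV ?S \<inter> {f. (\<Sum>i<n. (f i)\<^sup>2) = 1} = {f. (\<forall>i\<ge>n. f i = 0) \<and> (\<Sum>i<n. (f i)\<^sup>2) = 1}"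
    by blast
  ultimately show ?thesis by simp
qed

text \<open>A continuous function attains its maximum on the compact sphere, and homogeneity of
  degree 2 carries the bound to all vectors.\<close>

lemma rayleigh_quotient_max:
  fixes A :: "real mat"
  assumes A: "A \<in> carrier_mat m n" and n: "n \<ge> 1"
  obtains u where "u \<in> carrier_vec n" "u \<bullet> u = 1"
    "\<And>x. x \<in> carrier_vec n \<Longrightarrow> (A *\<^sub>v x) \<bullet> (A *\<^sub>v x) \<le> ((A *\<^sub>v u) \<bullet> (A *\<^sub>v u)) * (x \<bullet> x)"
proof -
  define S where "S = {f. (\<forall>i\<ge>n. f i = 0) \<and> (\<Sum>i<n. (f i)\<^sup>2) = (1::real)}"
  define q where "q f = (\<Sum>i<m. (\<Sum>j<n. A $$ (i, j) * f j)\<^sup>2)" for f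
  \<comment> \<open>The first unit vector shows that the sphere is nonempty; this is where
    \<open>n \<ge> 1\<close> enters.\<close>
  have "(\<lambda>i. if i = 0 then 1 else 0) \<in> S"
    using n by (auto simp: S_def if_distrib[of "\<lambda>x. x\<^sup>2"] cong: if_cong)
  hence "S \<noteq> {}" by blast
  moreover have "continuous_on S (\<lambda>f. f j)" for j
    by (rule continuous_on_subset[OF continuous_on_product_coordinates]) simp
  hence "continuous_on S q"
    unfolding q_def by (intro continuous_intros)
  ultimately obtain f where f: "f \<in> S" "\<And>g. g \<in> S \<Longrightarrow> q g \<le> q f"
    using continuous_attains_sup[OF compact_sphere_fun[of n, folded S_def]] by blast
  show thesis
  proof (rule that[of "vec n f"])
    show "vec n f \<in> carrier_vec n" by simp
    show "vec n f \<bullet> vec n f = 1"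
      using f(1) by (simp add: S_def scalar_prod_def power2_eq_square lessThan_atLeast0)
    fix x :: "real vec" assume x: "x \<in> carrier_vec n"
    \<comment> \<open>Padding with zeros puts \<open>g\<close>, once normalised, into
      \<open>S\<close>.\<close>
    define g where "g i = (if i < n then x $ i else 0)" for i
    have xg: "x = vec n g" using x by (auto simp: g_def)
    define s where "s = (\<Sum>i<n. (g i)\<^sup>2)"
    have s: "x \<bullet> x = s"
      unfolding xg s_def by (simp add: scalar_prod_def power2_eq_square lessThan_atLeast0)
    have "q g \<le> q f * s"
    proof (cases "s = 0")
      case True
      hence "\<forall>i<n. g i = 0"
        unfolding s_def by (subst (asm) sum_nonneg_eq_0_iff) auto
      thus ?thesis using True by (simp add: q_def)
    next
      case False
      hence "s > 0" unfolding s_def by (simp add: less_le sum_nonneg)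
      let ?h = "\<lambda>i. g i / sqrt s"
      have "?h \<in> S"
        using \<open>s > 0\<close> by (simp add: S_def g_def s_def power_divide flip: sum_divide_distrib)
      moreover have "q ?h = q g / s"
        using \<open>s > 0\<close> by (simp add: q_def power_divide flip: sum_divide_distrib)
      ultimately have "q g / s \<le> q f" using f(2) by metis
      thus ?thesis using \<open>s > 0\<close> by (simp add: field_simps)
    qed
    thus "(A *\<^sub>v x) \<bullet> (A *\<^sub>v x) \<le> ((A *\<^sub>v vec n f) \<bullet> (A *\<^sub>v vec n f)) * (x \<bullet> x)"
      unfolding s by (simp only: xg scalar_prod_mult_mat_vec[OF A] q_def)
  qed
qed

text \<open>For small \<open>t\<close> the linear term dominates, so a nonzero \<open>a\<close>
  would force a positive value. This serves as the first-order condition at a maximum without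
  derivatives.\<close>

lemma linear_coeff_zero_if_quadratic_nonpos:
  fixes a b :: real
  assumes "\<And>t. a * t + b * t\<^sup>2 \<le> 0"
  shows "a = 0"
proof (rule ccontr)
  assume "a \<noteq> 0"
  \<comment> \<open>This choice makes both \<open>d\<close> and \<open>d + b\<close> positive, hence
    also the value of the quadratic at \<open>a / d\<close>.\<close>
  define d where "d = \<bar>b\<bar> + 1"
  have d: "d > 0" "d + b > 0" unfolding d_def by auto
  let ?t = "a / d"
  have "a * ?t + b * ?t\<^sup>2 = (a\<^sup>2 * (d + b)) / d\<^sup>2"
    using d by (simp add: field_simps power2_eq_square)
  moreover have "\<dots> > 0"
    using \<open>a \<noteq> 0\<close> d by (intro divide_pos_pos mult_pos_pos) auto
  ultimately show False using assms[of ?t] by linarith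
qed

text \<open>A maximiser of the Rayleigh quotient is a critical point, hence an eigenvector.\<close>

lemma gram_eigenvalue_bound:
  fixes A :: "real mat"
  assumes A: "A \<in> carrier_mat m n" and n: "n \<ge> 1"
  obtains k where "eigenvalue (transpose_mat A * A) k" "k \<ge> 0"
    "\<And>x. x \<in> carrier_vec n \<Longrightarrow> (A *\<^sub>v x) \<bullet> (A *\<^sub>v x) \<le> k * (x \<bullet> x)"
proof -
  obtain u where u: "u \<in> carrier_vec n" "u \<bullet> u = 1"
    and max: "\<And>x. x \<in> carrier_vec n \<Longrightarrow> (A *\<^sub>v x) \<bullet> (A *\<^sub>v x) \<le> ((A *\<^sub>v u) \<bullet> (A *\<^sub>v u)) * (x \<bullet> x)"
    using rayleigh_quotient_max[OF A n] by blast
  define k where "k = (A *\<^sub>v u) \<bullet> (A *\<^sub>v u)"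
  have Au: "A *\<^sub>v u \<in> carrier_vec m" using A u by simp
  \<comment> \<open>Moving from \<open>u\<close> to \<open>u + t w\<close> turns maximality into a
    quadratic in \<open>t\<close> that is never positive and has no constant term; its linear
    coefficient must vanish.\<close>
  have critical: "(A *\<^sub>v u) \<bullet> (A *\<^sub>v w) = k * (u \<bullet> w)" if w: "w \<in> carrier_vec n" for w
  proof -
    have Aw: "A *\<^sub>v w \<in> carrier_vec m" using A w by simp
    have expand: "(a + t \<cdot>\<^sub>v b) \<bullet> (a + t \<cdot>\<^sub>v b) = a \<bullet> a + 2 * t * (a \<bullet> b) + t\<^sup>2 * (b \<bullet> b)"
      if "a \<in> carrier_vec l" "b \<in> carrier_vec l" for a b :: "real vec" and t l
      using that comm_scalar_prod[of b l a]
      by (simp add: add_scalar_prod_distrib[of _ l] scalar_prod_add_distrib[of _ l]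
          power2_eq_square distrib_left)
    have "2 * ((A *\<^sub>v u) \<bullet> (A *\<^sub>v w) - k * (u \<bullet> w)) * t
        + ((A *\<^sub>v w) \<bullet> (A *\<^sub>v w) - k * (w \<bullet> w)) * t\<^sup>2 \<le> 0" for t
    proof -
      have "A *\<^sub>v (u + t \<cdot>\<^sub>v w) = A *\<^sub>v u + t \<cdot>\<^sub>v (A *\<^sub>v w)"
        using A u w by (simp add: mult_add_distrib_mat_vec mult_mat_vec)
      hence "(A *\<^sub>v u + t \<cdot>\<^sub>v (A *\<^sub>v w)) \<bullet> (A *\<^sub>v u + t \<cdot>\<^sub>v (A *\<^sub>v w))
          \<le> k * ((u + t \<cdot>\<^sub>v w) \<bullet> (u + t \<cdot>\<^sub>v w))"
        using max[of "u + t \<cdot>\<^sub>v w"] u w by (simp add: k_def)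
      thus ?thesis
        unfolding expand[OF Au Aw] expand[OF u(1) w] u(2) k_def[symmetric]
        by (simp add: algebra_simps)
    qed
    from linear_coeff_zero_if_quadratic_nonpos[OF this] show ?thesis by simp
  qed
  have gram: "(transpose_mat A * A) *\<^sub>v u = transpose_mat A *\<^sub>v (A *\<^sub>v u)"
    using A u by (intro assoc_mult_mat_vec[of _ n m _ n]) auto
  have "transpose_mat A *\<^sub>v (A *\<^sub>v u) = k \<cdot>\<^sub>v u"
  proof (rule eq_vecI)
    fix i assume "i < dim_vec (k \<cdot>\<^sub>v u)"
    hence i: "i < n" using u by simp
    \<comment> \<open>Criticality in the direction of each unit vector gives the eigenvector
      equation coordinate by coordinate.\<close>
    have "(transpose_mat A *\<^sub>v (A *\<^sub>v u)) $ i = (transpose_mat A *\<^sub>v (A *\<^sub>v u)) \<bullet> unit_vec n i"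
      using A i by simp
    also have "\<dots> = (A *\<^sub>v u) \<bullet> (A *\<^sub>v unit_vec n i)"
      using transpose_vec_mult_scalar[OF A _ Au, of "unit_vec n i"] by simp
    also have "\<dots> = k * (u \<bullet> unit_vec n i)" by (rule critical) simp
    also have "\<dots> = (k \<cdot>\<^sub>v u) $ i" using u i by simp
    finally show "(transpose_mat A *\<^sub>v (A *\<^sub>v u)) $ i = (k \<cdot>\<^sub>v u) $ i" .
  qed (use A u in auto)
  moreover have "u \<noteq> 0\<^sub>v n" using u by auto
  ultimately have "eigenvector (transpose_mat A * A) u k"
    using A u gram unfolding eigenvector_def by simp
  hence "eigenvalue (transpose_mat A * A) k" unfolding eigenvalue_def by blast
  moreover have "k \<ge> 0" unfolding k_def scalar_prod_def by (intro sum_nonneg) simp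
  ultimately show thesis using that max unfolding k_def by blast
qed

text \<open>Eigenvalues of the Gram matrix are roots of its monic characteristic polynomial.
  Finiteness is what allows \<open>Max\<close> to be compared with its members.\<close>

lemma finite_singular_values:
  assumes "A \<in> carrier_mat m n"
  shows "finite (singular_values A)"
proof -
  have G: "transpose_mat A * A \<in> carrier_mat n n" using assms by auto
  hence "char_poly (transpose_mat A * A) \<noteq> 0"
    using degree_monic_char_poly[OF G] by auto
  thus ?thesis
    unfolding singular_values_def eigenvalue_root_char_poly[OF G]
    by (intro finite_imageI poly_roots_finite)
qed

text \<open>The square root of the Gram eigenvalue that bounds the Rayleigh quotient is itself a
  singular value, so the maximum dominates it.\<close>

lemma
  assumes A: "A \<in> carrier_mat m n" and n: "n \<ge> 1"
  shows largest_singular_value_nonneg: "largest_singular_value A \<ge> 0"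
    and largest_singular_value_bound:
      "(\<Sum>i<m. (\<Sum>j<n. A $$ (i, j) * f j)\<^sup>2) \<le> (largest_singular_value A)\<^sup>2 * (\<Sum>j<n. (f j)\<^sup>2)"
proof -
  obtain k where k: "eigenvalue (transpose_mat A * A) k" "k \<ge> 0"
    and bound: "\<And>x. x \<in> carrier_vec n \<Longrightarrow> (A *\<^sub>v x) \<bullet> (A *\<^sub>v x) \<le> k * (x \<bullet> x)"
    using gram_eigenvalue_bound[OF A n] by blast
  have "sqrt k \<le> largest_singular_value A"
    unfolding largest_singular_value_def using k(1)
    by (intro Max_ge finite_singular_values[OF A]) (simp add: singular_values_def)
  with k(2) show "largest_singular_value A \<ge> 0"
    by (meson order_trans real_sqrt_ge_zero)
  have "k \<le> (largest_singular_value A)\<^sup>2"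
    using power_mono[OF \<open>sqrt k \<le> largest_singular_value A\<close>, of 2] k(2) by simp
  hence "k * (\<Sum>j<n. (f j)\<^sup>2) \<le> (largest_singular_value A)\<^sup>2 * (\<Sum>j<n. (f j)\<^sup>2)"
    by (intro mult_right_mono sum_nonneg) auto
  moreover have "vec n f \<bullet> vec n f = (\<Sum>j<n. (f j)\<^sup>2)"
    by (simp add: scalar_prod_def power2_eq_square lessThan_atLeast0)
  ultimately show "(\<Sum>i<m. (\<Sum>j<n. A $$ (i, j) * f j)\<^sup>2)
      \<le> (largest_singular_value A)\<^sup>2 * (\<Sum>j<n. (f j)\<^sup>2)"
    using bound[of "vec n f"] by (simp add: scalar_prod_mult_mat_vec[OF A])
qed

section \<open>Norm estimates for the Tucker product\<close>

text \<open>Peels one mode off a sum over multi-indices, for the induction on modes.\<close>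

lemma sum_PiE_insert:
  assumes "a \<notin> I"
  shows "(\<Sum>f\<in>PiE (insert a I) T. g f) = (\<Sum>y\<in>T a. \<Sum>f\<in>PiE I T. g (f(a := y)))"
  unfolding PiE_insert_eq
  by (subst sum.reindex[OF inj_combinator[OF assms]]) (simp add: sum.cartesian_product case_prod_beta')

text \<open>
  Induction on the set of modes: the product over \<open>insert a I\<close> acts as the product over \<open>I\<close> on every
  slice, followed by the matrix \<open>M a\<close> on every fibre of mode \<open>a\<close>.
\<close>

lemma multilinear_sum_squares_bound:
  fixes M :: "'a \<Rightarrow> real mat" and J :: "'a \<Rightarrow> nat"
  assumes "finite I"
    and M: "\<And>n. n \<in> I \<Longrightarrow> M n \<in> carrier_mat (J n) (J n)"
    and J: "\<And>n. n \<in> I \<Longrightarrow> J n \<ge> 1"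
  defines "D \<equiv> \<lambda>I. PiE I (\<lambda>n. {..<J n})"
  shows "(\<Sum>i\<in>D I. (\<Sum>j\<in>D I. X j * (\<Prod>n\<in>I. M n $$ (i n, j n)))\<^sup>2)
      \<le> (\<Prod>n\<in>I. (largest_singular_value (M n))\<^sup>2) * (\<Sum>j\<in>D I. (X j)\<^sup>2)"
  using assms(1) M J
proof (induction I arbitrary: X rule: finite_induct)
  case empty
  show ?case by (simp add: D_def)
next
  case (insert a I)
  let ?s = "\<lambda>n. (largest_singular_value (M n))\<^sup>2"
  \<comment> \<open>\<open>Y b\<close> is the product over the modes in \<open>I\<close> applied to
    the slice of \<open>X\<close> whose index in mode \<open>a\<close> is \<open>b\<close>.\<close>
  define Y where "Y b i = (\<Sum>j\<in>D I. X (j(a := b)) * (\<Prod>n\<in>I. M n $$ (i n, j n)))" for b i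
  have split: "(\<Sum>f\<in>D (insert a I). g f) = (\<Sum>y<J a. \<Sum>f\<in>D I. g (f(a := y)))"
    for g :: "('a \<Rightarrow> nat) \<Rightarrow> real"
    unfolding D_def using insert.hyps(2) by (rule sum_PiE_insert)
  have prod: "(\<Prod>n\<in>insert a I. M n $$ ((i(a := x)) n, (j(a := y)) n))
      = M a $$ (x, y) * (\<Prod>n\<in>I. M n $$ (i n, j n))" for i j x y
    using insert.hyps by (auto intro!: prod.cong)
  have "(\<Sum>i\<in>D (insert a I). (\<Sum>j\<in>D (insert a I). X j * (\<Prod>n\<in>insert a I. M n $$ (i n, j n)))\<^sup>2)
      = (\<Sum>x<J a. \<Sum>i\<in>D I. (\<Sum>y<J a. M a $$ (x, y) * Y y i)\<^sup>2)"
    unfolding split prod Y_def sum_distrib_left by (simp add: mult.left_commute)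
  \<comment> \<open>With \<open>i\<close> fixed outside, the inner sums are the squared norm of
    \<open>M a\<close> applied to one fibre.\<close>
  also have "\<dots> = (\<Sum>i\<in>D I. \<Sum>x<J a. (\<Sum>y<J a. M a $$ (x, y) * Y y i)\<^sup>2)"
    by (rule sum.swap)
  also have "\<dots> \<le> (\<Sum>i\<in>D I. ?s a * (\<Sum>y<J a. (Y y i)\<^sup>2))"
    using insert.prems by (intro sum_mono largest_singular_value_bound) auto
  also have "\<dots> = ?s a * (\<Sum>y<J a. \<Sum>i\<in>D I. (Y y i)\<^sup>2)"
    unfolding sum_distrib_left[symmetric] by (subst sum.swap) (rule refl)
  \<comment> \<open>The induction hypothesis holds for arbitrary \<open>X\<close>, so it applies to
    each slice.\<close>
  also have "\<dots> \<le> ?s a * (\<Sum>y<J a. (\<Prod>n\<in>I. ?s n) * (\<Sum>j\<in>D I. (X (j(a := y)))\<^sup>2))"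
    unfolding Y_def using insert.prems by (intro mult_left_mono sum_mono insert.IH) auto
  also have "\<dots> = (\<Prod>n\<in>insert a I. ?s n) * (\<Sum>j\<in>D (insert a I). (X j)\<^sup>2)"
    unfolding split using insert.hyps by (simp add: sum_distrib_left mult.assoc)
  finally show ?case .
qed

lemma frobenius_norm_eq_L2_set: "frobenius_norm N J X = L2_set X (multi_index N J)"
  by (simp add: frobenius_norm_def L2_set_def)

lemma frobenius_norm_nonneg: "frobenius_norm N J X \<ge> 0"
  by (simp add: frobenius_norm_eq_L2_set)

lemma frobenius_norm_tucker_product:
  assumes "\<And>n. n \<in> {1..N} \<Longrightarrow> M n \<in> carrier_mat (J n) (J n)"
    and "\<And>n. n \<in> {1..N} \<Longrightarrow> J n \<ge> 1"
  shows "frobenius_norm N J (tucker_product N J X M)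
      \<le> (\<Prod>n=1..N. largest_singular_value (M n)) * frobenius_norm N J X"
proof -
  \<comment> \<open>The sign matters when the squared estimate is reduced by square roots.\<close>
  have "0 \<le> (\<Prod>n=1..N. largest_singular_value (M n))"
    by (intro prod_nonneg largest_singular_value_nonneg[OF assms])
  moreover have "(\<Sum>i\<in>multi_index N J. (tucker_product N J X M i)\<^sup>2)
      \<le> (\<Prod>n=1..N. largest_singular_value (M n))\<^sup>2 * (\<Sum>i\<in>multi_index N J. (X i)\<^sup>2)"
    using multilinear_sum_squares_bound[of "{1..N}" M J X] assms
    by (simp add: tucker_product_def multi_index_def prod_power_distrib[symmetric])
  ultimately show ?thesis
    unfolding frobenius_norm_def
    by (metis (no_types, lifting) real_sqrt_le_mono real_sqrt_mult real_sqrt_unique)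
qed

text \<open>Minkowski's inequality, iterated over the summands.\<close>

lemma L2_set_sum_le: "L2_set (\<lambda>i. \<Sum>r\<in>S. f r i) I \<le> (\<Sum>r\<in>S. L2_set (f r) I)"
proof (induction S rule: infinite_finite_induct)
  case (insert r S)
  have "L2_set (\<lambda>i. f r i + (\<Sum>r\<in>S. f r i)) I \<le> L2_set (f r) I + L2_set (\<lambda>i. \<Sum>r\<in>S. f r i) I"
    by (rule L2_set_triangle_ineq)
  with insert show ?case by simp
qed (simp_all add: L2_set_def)

section \<open>Growth of the norm along trajectories\<close>

lemma frobenius_norm_mlti_step:
  assumes "\<And>r n. r \<in> {1..R} \<Longrightarrow> n \<in> {1..N} \<Longrightarrow> A r n \<in> carrier_mat (J n) (J n)"
    and "\<And>n. n \<in> {1..N} \<Longrightarrow> J n \<ge> 1"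
  shows "frobenius_norm N J (mlti_step N J R A X)
      \<le> (\<Sum>r=1..R. \<Prod>n=1..N. largest_singular_value (A r n)) * frobenius_norm N J X"
proof -
  have "frobenius_norm N J (mlti_step N J R A X)
      = L2_set (\<lambda>i. \<Sum>r=1..R. tucker_product N J X (A r) i) (multi_index N J)"
    unfolding frobenius_norm_eq_L2_set by (intro L2_set_cong) (auto simp: mlti_step_def)
  also have "\<dots> \<le> (\<Sum>r=1..R. frobenius_norm N J (tucker_product N J X (A r)))"
    unfolding frobenius_norm_eq_L2_set by (rule L2_set_sum_le)
  also have "\<dots> \<le> (\<Sum>r=1..R. (\<Prod>n=1..N. largest_singular_value (A r n)) * frobenius_norm N J X)"
    using assms by (intro sum_mono frobenius_norm_tucker_product) auto
  finally show ?thesis by (simp add: sum_distrib_right)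
qed

lemma trajectory_norm_bound:
  assumes "trajectory N J F X" "c \<ge> 0"
    and step: "\<And>X. frobenius_norm N J (F X) \<le> c * frobenius_norm N J X"
  shows "frobenius_norm N J (X t) \<le> c ^ t * frobenius_norm N J (X 0)"
proof (induction t)
  case (Suc t)
  have "frobenius_norm N J (X (Suc t)) \<le> c * frobenius_norm N J (X t)"
    using assms(1) step by (simp add: trajectory_def)
  also have "\<dots> \<le> c * (c ^ t * frobenius_norm N J (X 0))"
    using Suc \<open>c \<ge> 0\<close> by (rule mult_left_mono)
  finally show ?case by (simp add: mult.assoc)
qed simp

theorem proposition6p6:
  fixes N R\<^sub>1 :: nat and J :: "nat \<Rightarrow> nat" and A :: "nat \<Rightarrow> nat \<Rightarrow> real mat"
  assumes "N \<ge> 1"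
    and "\<And>n. n \<in> {1..N} \<Longrightarrow> J n \<ge> 1"
    and "\<And>r n. r \<in> {1..R\<^sub>1} \<Longrightarrow> n \<in> {1..N} \<Longrightarrow> A r n \<in> carrier_mat (J n) (J n)"
    and "R\<^sub>1 = kronecker_rank N J (outer_product_sum N J R\<^sub>1 A)"
  shows "((\<Sum>r=1..R\<^sub>1. \<Prod>n=1..N. largest_singular_value (A r n)) = 1
            \<longrightarrow> zero_stable N J (mlti_step N J R\<^sub>1 A)) \<and>
         ((\<Sum>r=1..R\<^sub>1. \<Prod>n=1..N. largest_singular_value (A r n)) < 1
            \<longrightarrow> zero_asymptotically_stable N J (mlti_step N J R\<^sub>1 A))"
proof -
  define c where "c = (\<Sum>r=1..R\<^sub>1. \<Prod>n=1..N. largest_singular_value (A r n))"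
  have "c \<ge> 0"
    unfolding c_def
    by (intro sum_nonneg prod_nonneg largest_singular_value_nonneg[OF assms(3) assms(2)])
  have bound: "frobenius_norm N J (X t) \<le> c ^ t * frobenius_norm N J (X 0)"
    if "trajectory N J (mlti_step N J R\<^sub>1 A) X" for X t
    using that \<open>c \<ge> 0\<close>
  proof (rule trajectory_norm_bound)
    show "frobenius_norm N J (mlti_step N J R\<^sub>1 A X) \<le> c * frobenius_norm N J X" for X
      unfolding c_def using assms(2,3) by (intro frobenius_norm_mlti_step)
  qed
  \<comment> \<open>Here \<open>c ^ t = 1\<close>, so the norm never exceeds its initial value and
    \<gamma> = 1 works.\<close>
  have "zero_stable N J (mlti_step N J R\<^sub>1 A)" if "c = 1"
    unfolding zero_stable_def using bound that by (intro exI[of _ 1]) auto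
  moreover have "zero_asymptotically_stable N J (mlti_step N J R\<^sub>1 A)" if "c < 1"
    unfolding zero_asymptotically_stable_def
  proof (intro allI impI)
    fix X assume X: "trajectory N J (mlti_step N J R\<^sub>1 A) X"
    \<comment> \<open>For \<open>0 \<le> c < 1\<close> the geometric bound tends to zero and
      squeezes the norm.\<close>
    have "(\<lambda>t. c ^ t * frobenius_norm N J (X 0)) \<longlonglongrightarrow> 0 * frobenius_norm N J (X 0)"
      using that \<open>c \<ge> 0\<close> by (intro tendsto_mult_right LIMSEQ_realpow_zero)
    hence lim: "(\<lambda>t. c ^ t * frobenius_norm N J (X 0)) \<longlonglongrightarrow> 0" by simp
    show "(\<lambda>t. frobenius_norm N J (X t)) \<longlonglongrightarrow> 0"
      by (rule tendsto_sandwich[OF _ _ tendsto_const lim])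
        (simp_all add: bound[OF X] frobenius_norm_nonneg)
  qed
  ultimately show ?thesis unfolding c_def by blast
qed

end
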